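(* For every integer $n\ge 0$, \begin{align*} H_{8n}(G(x,8)) &=H_{8n+1}(G(x,8))=1,\\ H_{8n+2}(G(x,8)) &=-\tfrac2{15} ( n+1 )( 256n^{2}+192n+15 )( 256n^{2}+192n+17 ),\\ H_{8n+3}(G(x,8)) &=\tfrac{16}{45} ( 65536n^{4}+262144n^{3}+272896n^{2}+79104n-3915 )( n+1 ) ^{2},\\ H_{8n+4}(G(x,8)) &=-H_{8n+5}(G(x,8))=4096 ( n+1 ) ^{3},\\ H_{8n+6}(G(x,8))&=\tfrac{16}{45} ( 65536n^{4}+262144n^{3}+272896n^{2}-36096n-119115 )( n+1 ) ^{2},\\ H_{8n+7}(G(x,8))&=\tfrac2{15} ( n+1 )( 256n^{2}+832n+655 )( 256n^{2}+832n+657 ). \end{align*}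
   Context: For a power series $A(x)=\sum_{n\ge 0}a_nx^n$, the Hankel determinants are $H_n(A(x))=\det(a_{i+j})_{0\le i,j\le n-1}$ for $n\ge 1$, with $H_0(A(x))=1$. For a nonnegative integer $r$, $G(x,r)=\sum_{n\ge 0}\binom{2n+r}{n}x^n$; equivalently $G(x,r)=\frac{C(x)^r}{1-2xC(x)}=\frac{C(x)^r}{\sqrt{1-4x}}$, where $C(x)=\sum_{n\ge0}\frac1{n+1}\binom{2n}{n}x^n$. *)

theory Defs
  imports
    "HOL-Computational_Algebra.Formal_Power_Series"
    "Jordan_Normal_Form.Determinant"
begin

text \<open>For \<open>n = 0\<close> the determinant of the empty matrix is 1, matching the convention
  that the Hankel determinant of order 0 is 1.\<close>

definition hankel_det :: "'a :: comm_ring_1 fps \<Rightarrow> nat \<Rightarrow> 'a" where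
  "hankel_det A n = det (mat n n (\<lambda>(i, j). fps_nth A (i + j)))"

lemma hankel_det_0: "hankel_det A 0 = 1"
  by (simp add: hankel_det_def det_def)

definition G :: "nat \<Rightarrow> rat fps" where
  "G r = Abs_fps (\<lambda>n. of_nat ((2 * n + r) choose n))"

end

theory Submission
  imports Defs
begin

text \<open>
  The moments \<open>(2m + r + 2 choose m)\<close> are constant terms of \<open>x\<^sup>m (1 + z)\<^bsup>r+2\<^esup>\<close> with
  \<open>x = (1 + z)\<^sup>2 / z\<close>.  A Hankel determinant does not change if the powers of \<open>x\<close> are replaced by other
  monic polynomials.  With the Chebyshev polynomials
  \<open>V\<^sub>i = (z\<^bsup>i+1/2\<^esup> + z\<^bsup>-i-1/2\<^esup>) / (z\<^bsup>1/2\<^esup> + z\<^bsup>-1/2\<^esup>)\<close> the two denominators cancel two factors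
  \<open>1 + z\<close> of the weight, and the matrix becomes a banded Toeplitz matrix with a reflected
  boundary: its entries are \<open>c(i - j) + c(i + j + 1)\<close>, where the symbol of \<open>c\<close> is
  \<open>z (1 + z)\<^sup>r + z\<^bsup>-1\<^esup> (1 + z\<^bsup>-1\<^esup>)\<^sup>r\<close> (lemma \<open>hankel_det_G_eq_band_det\<close>).

  The determinant of an \<open>n \<times> n\<close> corner of such a band matrix is, up to sign, the quotient of two
  determinants of size \<open>r + 1\<close>: the values of a basis of the kernel at the indices
  \<open>n, \<dots>, n + r\<close>, over the values at \<open>0, \<dots>, r\<close> (lemma \<open>band_det_via_kernel\<close>).  The kernel consists of
  the solutions of the Toeplitz recurrence that are symmetric about \<open>-1/2\<close>
  (lemma \<open>band_entry_action\<close>).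

  For \<open>r = 6\<close> the symbol is \<open>z\<^bsup>-7\<^esup> (1 + z)\<^sup>6 (1 + z\<^sup>8)\<close>.  Its kernel is spanned by four sequences that
  change sign after 8 steps and by \<open>(-1)\<^sup>j (2j + 1)\<^sup>e\<close> for \<open>e = 1, 3, 5\<close>
  (lemma \<open>kernel_seq_annihilated\<close>).  This explains the result: the dependence on \<open>n\<close> modulo 8 comes
  from the antiperiodic sequences, the polynomial dependence on \<open>n div 8\<close> from the alternating
  ones.  It remains to evaluate one \<open>7 \<times> 7\<close> determinant with polynomial entries for each residue.
\<close>

section \<open>Passage to a band matrix\<close>

text \<open>
  The left-hand side is the Gram matrix of the bilinear form \<open>h\<close> in a new basis whose transition
  matrix is lower unitriangular.  For a Hankel matrix this is the freedom to replace the powers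
  of the variable by an arbitrary sequence of monic polynomials, one in each degree.
\<close>
lemma det_unitriangular_congruence:
  fixes c h :: "nat \<Rightarrow> nat \<Rightarrow> 'a :: comm_ring_1"
  assumes "\<And>i. c i i = 1"
  shows "det (mat n n (\<lambda>(i, j). \<Sum>k\<le>i. \<Sum>l\<le>j. c i k * c j l * h k l)) =
         det (mat n n (\<lambda>(i, j). h i j))"
proof -
  define L where "L = mat n n (\<lambda>(i, k). if k \<le> i then c i k else 0)"
  define A where "A = mat n n (\<lambda>(i, j). h i j)"
  have carr: "L \<in> carrier_mat n n" "A \<in> carrier_mat n n"
    by (simp_all add: L_def A_def)
  have "det L = prod_list (diag_mat L)"
    by (rule det_lower_triangular[OF _ carr(1)]) (simp add: L_def)
  also have "\<dots> = 1"
    using assms by (simp add: prod_list_diag_prod L_def)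
  finally have det_L: "det L = 1" .
  have restrict: "(\<Sum>k<n. (if k \<le> i then g k else 0)) = (\<Sum>k\<le>i. g k)"
    if "i < n" for i and g :: "nat \<Rightarrow> 'a"
  proof -
    have "{k \<in> {..<n}. k \<le> i} = {..i}" using that by auto
    then show ?thesis by (simp add: sum.If_cases Int_def)
  qed
  have "mat n n (\<lambda>(i, j). \<Sum>k\<le>i. \<Sum>l\<le>j. c i k * c j l * h k l) = L * A * L\<^sup>T"
  proof (rule eq_matI)
    fix i j assume "i < dim_row (L * A * L\<^sup>T)" and "j < dim_col (L * A * L\<^sup>T)"
    then have ij: "i < n" "j < n" by (simp_all add: L_def A_def)
    have entry: "(B * C) $$ (i, m) = (\<Sum>l<n. B $$ (i, l) * C $$ (l, m))"
      if "B \<in> carrier_mat n n" "C \<in> carrier_mat n n" "m < n" for B C :: "'a mat" and m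
      using that ij by (auto simp: scalar_prod_def lessThan_atLeast0 intro!: sum.cong)
    have LA: "(L * A) $$ (i, l) = (\<Sum>k\<le>i. c i k * h k l)" if "l < n" for l
    proof -
      have "(L * A) $$ (i, l) = (\<Sum>k<n. if k \<le> i then c i k * h k l else 0)"
        unfolding entry[OF carr that] using ij that
        by (intro sum.cong) (auto simp: L_def A_def)
      then show ?thesis using restrict[OF ij(1)] by simp
    qed
    have "(L * A * L\<^sup>T) $$ (i, j) = (\<Sum>l<n. (L * A) $$ (i, l) * L\<^sup>T $$ (l, j))"
      using ij carr by (intro entry) auto
    also have "\<dots> = (\<Sum>l<n. if l \<le> j then (\<Sum>k\<le>i. c i k * h k l) * c j l else 0)"
      using ij by (intro sum.cong) (simp_all add: LA, simp_all add: L_def)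
    also have "\<dots> = (\<Sum>l\<le>j. \<Sum>k\<le>i. c i k * c j l * h k l)"
      by (simp add: restrict[OF ij(2)] sum_distrib_left sum_distrib_right mult_ac)
    also have "\<dots> = (\<Sum>k\<le>i. \<Sum>l\<le>j. c i k * c j l * h k l)"
      by (rule sum.swap)
    finally show "mat n n (\<lambda>(i, j). \<Sum>k\<le>i. \<Sum>l\<le>j. c i k * c j l * h k l) $$ (i, j) =
        (L * A * L\<^sup>T) $$ (i, j)"
      using ij by simp
  qed (simp_all add: L_def A_def)
  moreover have "det (L * A * L\<^sup>T) = det A"
    using carr det_L by (simp add: det_mult[of _ n] det_transpose)
  ultimately show ?thesis by (simp add: A_def)
qed

text \<open>
  Coefficients, in the variable \<open>x = (1 + z)\<^sup>2 / z\<close>, of the monic polynomials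
  \<open>V\<^sub>i = (z\<^bsup>i+1/2\<^esup> + z\<^bsup>-i-1/2\<^esup>) / (z\<^bsup>1/2\<^esup> + z\<^bsup>-1/2\<^esup>)\<close>, the Chebyshev polynomials of the
  third kind for \<open>x = 2 + 2 cos \<theta>\<close> and \<open>z = exp(\<i> \<theta>)\<close>.  They satisfy
  \<open>V\<^bsub>i+2\<^esub> = (x - 2) V\<^bsub>i+1\<^esub> - V\<^sub>i\<close>.
\<close>
fun cheb_V :: "nat \<Rightarrow> nat \<Rightarrow> rat" where
  "cheb_V 0 k = (if k = 0 then 1 else 0)"
| "cheb_V (Suc 0) k = (if k = 0 then - 3 else if k = 1 then 1 else 0)"
| "cheb_V (Suc (Suc i)) k =
     (case k of 0 \<Rightarrow> 0 | Suc l \<Rightarrow> cheb_V (Suc i) l) - 2 * cheb_V (Suc i) k - cheb_V i k"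

lemma cheb_V_zero: "i < k \<Longrightarrow> cheb_V i k = 0"
  by (induction i k rule: cheb_V.induct) (auto split: nat.split)

lemma cheb_V_monic: "cheb_V i i = 1"
  by (induction i rule: induct_nat_012) (simp_all add: cheb_V_zero)

text \<open>
  The Laurent polynomial \<open>V\<^sub>i\<close> multiplied by \<open>z\<^sup>i\<close>, which clears the negative powers of \<open>z\<close>.
\<close>
definition cheb_V_fps :: "nat \<Rightarrow> rat fps" where
  "cheb_V_fps i =
     (\<Sum>k\<le>i. fps_const (cheb_V i k) * (fps_X ^ (i - k) * (1 + fps_X) ^ (2 * k)))"

lemma cheb_V_fps_rec:
  "cheb_V_fps (Suc (Suc i)) =
     (1 + fps_X ^ 2) * cheb_V_fps (Suc i) - fps_X ^ 2 * cheb_V_fps i"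
proof -
  define w :: "nat \<Rightarrow> nat \<Rightarrow> rat fps" where "w d k = fps_X ^ (d - k) * (1 + fps_X) ^ (2 * k)" for d k
  let ?c = "\<lambda>i k. fps_const (cheb_V i k)"
  have w_Suc: "w (Suc d) (Suc k) = (1 + fps_X)\<^sup>2 * w d k" for d k
    by (simp add: w_def power2_eq_square mult_ac)
  have w_X: "w (Suc d) k = fps_X * w d k" if "k \<le> d" for d k
    using that by (simp add: w_def Suc_diff_le mult_ac)
  have "cheb_V_fps (Suc (Suc i)) =
      (\<Sum>k\<le>Suc (Suc i). fps_const (case k of 0 \<Rightarrow> 0 | Suc l \<Rightarrow> cheb_V (Suc i) l) * w (Suc (Suc i)) k)
      - fps_const 2 * (\<Sum>k\<le>Suc (Suc i). ?c (Suc i) k * w (Suc (Suc i)) k)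
      - (\<Sum>k\<le>Suc (Suc i). ?c i k * w (Suc (Suc i)) k)"
    by (simp add: cheb_V_fps_def w_def[symmetric] sum_subtractf sum_distrib_left
        left_diff_distrib mult.assoc fps_const_sub[symmetric] fps_const_mult[symmetric]
        del: fps_const_sub fps_const_mult sum.atMost_Suc)
  also have "(\<Sum>k\<le>Suc (Suc i). fps_const (case k of 0 \<Rightarrow> 0 | Suc l \<Rightarrow> cheb_V (Suc i) l) * w (Suc (Suc i)) k)
      = (1 + fps_X)\<^sup>2 * cheb_V_fps (Suc i)"
    by (subst sum.atMost_Suc_shift)
       (simp add: w_Suc cheb_V_fps_def w_def[of "Suc i", symmetric] sum_distrib_left
         mult.left_commute del: sum.atMost_Suc)
  also have "(\<Sum>k\<le>Suc (Suc i). ?c (Suc i) k * w (Suc (Suc i)) k) = (\<Sum>k\<le>Suc i. ?c (Suc i) k * w (Suc (Suc i)) k)"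
    by (subst sum.atMost_Suc) (simp add: cheb_V_zero del: sum.atMost_Suc)
  also have "\<dots> = fps_X * cheb_V_fps (Suc i)"
    unfolding cheb_V_fps_def w_def[symmetric] sum_distrib_left
    by (rule sum.cong) (simp_all add: w_X mult_ac)
  also have "(\<Sum>k\<le>Suc (Suc i). ?c i k * w (Suc (Suc i)) k) = (\<Sum>k\<le>i. ?c i k * w (Suc (Suc i)) k)"
    by (simp add: cheb_V_zero)
  also have "\<dots> = fps_X ^ 2 * cheb_V_fps i"
    unfolding cheb_V_fps_def w_def[symmetric] sum_distrib_left
    by (rule sum.cong) (simp_all add: w_X power2_eq_square mult_ac)
  finally show ?thesis
    by (simp add: algebra_simps power2_eq_square numeral_fps_const[symmetric])
qed

text \<open>
  The closed form of \<open>z\<^sup>i V\<^sub>i\<close>.  The factor \<open>1 + z\<close> on the left is what makes this family the right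
  one: two polynomials \<open>V\<^sub>i V\<^sub>j\<close> absorb two of the factors \<open>1 + z\<close> of the weight, and what remains
  is sparse.
\<close>
lemma cheb_V_fps: "(1 + fps_X) * cheb_V_fps i = 1 + fps_X ^ (2 * i + 1)"
proof (induction i rule: induct_nat_012)
  case 0
  then show ?case by (simp add: cheb_V_fps_def)
next
  case 1
  have first: "cheb_V_fps (Suc 0) = 1 - fps_X + fps_X ^ 2"
    by (simp add: cheb_V_fps_def power2_eq_square algebra_simps
        fps_const_neg[symmetric] numeral_fps_const[symmetric] del: fps_const_neg)
  show ?case
    unfolding first by (simp add: algebra_simps power2_eq_square power3_eq_cube)
next
  case (ge2 i)
  have "(1 + fps_X) * cheb_V_fps (Suc (Suc i)) =
      (1 + fps_X ^ 2) * ((1 + fps_X) * cheb_V_fps (Suc i))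
      - fps_X ^ 2 * ((1 + fps_X) * cheb_V_fps i)"
    by (simp add: cheb_V_fps_rec algebra_simps)
  then show ?case
    unfolding ge2.IH by (simp add: algebra_simps power_add power2_eq_square)
qed

lemma nth_one_plus_X_power: "fps_nth ((1 + fps_X) ^ m :: rat fps) n = of_nat (m choose n)"
  by (simp add: fps_binomial_of_nat[symmetric] binomial_gbinomial)

text \<open>
  The coefficient of \<open>z\<^bsup>i+j\<^esup>\<close> in \<open>(1 + z)\<^sup>r (1 + z\<^bsup>2i+1\<^esup>) (1 + z\<^bsup>2j+1\<^esup>)\<close>.  Each of the three summands
  vanishes unless its index is at most \<open>r\<close>, so the matrix is a symmetric Toeplitz band of
  half-width \<open>r + 1\<close> plus a Hankel term in the top left corner.
\<close>
definition band_entry :: "nat \<Rightarrow> nat \<Rightarrow> nat \<Rightarrow> rat" where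
  "band_entry r i j = of_nat (r choose (i + j))
     + (if i < j then of_nat (r choose (j - i - 1)) else 0)
     + (if j < i then of_nat (r choose (i - j - 1)) else 0)"

text \<open>
  The moment \<open>(2m + r + 2 choose m)\<close> is the constant term of \<open>x\<^sup>m (1 + z)\<^bsup>r+2\<^esup>\<close>.  Hence by linearity
  the left-hand side is the constant term of \<open>V\<^sub>i V\<^sub>j (1 + z)\<^bsup>r+2\<^esup>\<close>, and both denominators \<open>1 + z\<close>
  of \<open>V\<^sub>i V\<^sub>j\<close> cancel against the weight.
\<close>
lemma band_entry_eq_moment:
  "(\<Sum>k\<le>i. \<Sum>l\<le>j. cheb_V i k * cheb_V j l * fps_nth (G (r + 2)) (k + l)) = band_entry r i j"
proof -
  let ?P = cheb_V_fps
  let ?X = "fps_X :: rat fps"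
  have moment: "fps_nth (G (r + 2)) (k + l) =
      fps_nth ((1 + ?X) ^ (r + 2) * (?X ^ (i - k) * (1 + ?X) ^ (2 * k)) * (?X ^ (j - l) * (1 + ?X) ^ (2 * l))) (i + j)"
    if "k \<le> i" "l \<le> j" for k l
  proof -
    have "(1 + ?X) ^ (r + 2) * (?X ^ (i - k) * (1 + ?X) ^ (2 * k)) * (?X ^ (j - l) * (1 + ?X) ^ (2 * l))
        = ?X ^ ((i - k) + (j - l)) * (1 + ?X) ^ (2 * (k + l) + (r + 2))"
      by (simp add: power_add mult_ac distrib_left)
    moreover have "i + j - ((i - k) + (j - l)) = k + l" "\<not> i + j < (i - k) + (j - l)"
      using that by simp_all
    ultimately show ?thesis
      by (simp add: fps_X_power_mult_nth nth_one_plus_X_power G_def del: power_Suc power_add)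
  qed
  have "(\<Sum>k\<le>i. \<Sum>l\<le>j. cheb_V i k * cheb_V j l * fps_nth (G (r + 2)) (k + l)) =
      fps_nth ((1 + ?X) ^ (r + 2) * ?P i * ?P j) (i + j)"
  proof -
    have "(1 + ?X) ^ (r + 2) * ?P i * ?P j = (\<Sum>k\<le>i. \<Sum>l\<le>j. fps_const (cheb_V i k * cheb_V j l) *
      ((1 + ?X) ^ (r + 2) * (?X ^ (i - k) * (1 + ?X) ^ (2 * k)) * (?X ^ (j - l) * (1 + ?X) ^ (2 * l))))"
      unfolding cheb_V_fps_def sum_distrib_left sum_distrib_right
      by (subst sum.swap) (simp add: mult_ac fps_const_mult[symmetric] del: fps_const_mult)
    then show ?thesis
      by (simp add: fps_sum_nth moment del: power_Suc power_add power_add_numeral2 add_2_eq_Suc')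
  qed
  also have "(1 + ?X) ^ (r + 2) * ?P i * ?P j = (1 + ?X) ^ r * ((1 + ?X) * ?P i) * ((1 + ?X) * ?P j)"
    by (simp add: power2_eq_square power_add mult_ac)
  also have "\<dots> = (1 + ?X) ^ r + ?X ^ (2 * i + 1) * (1 + ?X) ^ r + ?X ^ (2 * j + 1) * (1 + ?X) ^ r
      + ?X ^ (2 * i + 2 * j + 2) * (1 + ?X) ^ r"
    unfolding cheb_V_fps by (simp add: algebra_simps power_add power2_eq_square)
  also have "fps_nth \<dots> (i + j) = band_entry r i j"
  proof -
    have "i + j - (2 * i + 1) = j - i - 1" "i + j - (2 * j + 1) = i - j - 1"
      "i + j < 2 * i + 1 \<longleftrightarrow> \<not> i < j" "i + j < 2 * j + 1 \<longleftrightarrow> \<not> j < i"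
      by linarith+
    then show ?thesis
      by (simp only: fps_add_nth fps_X_power_mult_nth nth_one_plus_X_power band_entry_def) simp
  qed
  finally show ?thesis .
qed

lemma hankel_det_G_eq_band_det:
  "hankel_det (G (r + 2)) n = det (mat n n (\<lambda>(i, j). band_entry r i j))"
  unfolding hankel_det_def
  by (subst det_unitriangular_congruence[of cheb_V, OF cheb_V_monic, symmetric])
     (simp only: band_entry_eq_moment)

section \<open>Determinants of band matrices\<close>

text \<open>
  The first \<open>n\<close> rows of a band matrix reach \<open>n + b\<close> columns, and because the outermost diagonal is
  1, a solution of the corresponding homogeneous equations is determined by its first \<open>b\<close> entries.
  The determinant of the \<open>n \<times> n\<close> corner measures how much volume this solution space has in the last
  \<open>b\<close> coordinates compared to the first \<open>b\<close> ones.  This follows from multiplying the block matrix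
  \<open>Y\<close> with rows \<open>v a\<close> and \<open>(1 | 0)\<close> by the unitriangular matrix \<open>S\<close> with columns \<open>(1 | 0)\<^sup>T\<close> and the
  rows of \<open>M\<close>: the kernel condition makes the product block triangular.
\<close>
lemma band_det_via_kernel:
  fixes M v :: "nat \<Rightarrow> nat \<Rightarrow> 'a :: idom"
  assumes band: "\<And>i j. i + b < j \<Longrightarrow> M i j = 0"
    and outer: "\<And>i. M i (i + b) = 1"
    and kernel: "\<And>a i. a < b \<Longrightarrow> i < n \<Longrightarrow> (\<Sum>j<n + b. M i j * v a j) = 0"
  shows "det (mat b b (\<lambda>(a, t). v a (n + t))) =
         (-1) ^ (b * n) * det (mat b b (\<lambda>(a, t). v a t)) * det (mat n n (\<lambda>(i, j). M i j))"
proof -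
  define S where "S = mat (b + n) (b + n)
    (\<lambda>(j, c). if c < b then (if j = c then 1 else 0) else M (c - b) j)"
  define Y where "Y = mat (b + n) (b + n)
    (\<lambda>(a, j). if a < b then v a j else if j = a - b then 1 else 0)"
  have carr: "S \<in> carrier_mat (b + n) (b + n)" "Y \<in> carrier_mat (b + n) (b + n)"
    by (simp_all add: S_def Y_def)
  have "upper_triangular S"
    by (intro upper_triangularI) (auto simp: S_def intro!: band)
  then have "det S = prod_list (diag_mat S)"
    using carr(1) by (rule det_upper_triangular)
  also have "\<dots> = 1"
    using outer by (auto simp: prod_list_diag_prod S_def intro!: prod.neutral)
      (metis add.commute le_add_diff_inverse not_less)
  finally have det_S: "det S = 1" .
  have entry: "(Y * S) $$ (a, c) = (\<Sum>j<b + n. Y $$ (a, j) * S $$ (j, c))" if "a < b + n" "c < b + n" for a c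
    using that carr by (auto simp: scalar_prod_def lessThan_atLeast0 intro!: sum.cong)
  have "Y * S = four_block_mat (mat b b (\<lambda>(a, t). v a t)) (0\<^sub>m b n)
      (mat n b (\<lambda>(i, c). (Y * S) $$ (i + b, c))) (mat n n (\<lambda>(i, j). M j i))"
    (is "_ = ?B")
  proof (rule eq_matI)
    fix a c assume "a < dim_row ?B" "c < dim_col ?B"
    then have ac: "a < b + n" "c < b + n" by simp_all
    consider "a < b" "c < b" | "a < b" "b \<le> c" | "b \<le> a" "c < b" | "b \<le> a" "b \<le> c" by linarith
    then show "(Y * S) $$ (a, c) = ?B $$ (a, c)"
    proof cases
      case 1
      then have "(Y * S) $$ (a, c) = (\<Sum>j<b + n. if j = c then v a j else 0)"
        unfolding entry[OF ac] by (intro sum.cong) (auto simp: Y_def S_def)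
      then show ?thesis using 1 ac by simp
    next
      case 2
      then have "(Y * S) $$ (a, c) = (\<Sum>j<n + b. M (c - b) j * v a j)"
        unfolding entry[OF ac] using ac by (intro sum.cong) (auto simp: Y_def S_def)
      also have "\<dots> = 0" using 2 ac by (intro kernel) auto
      finally show ?thesis using 2 ac by simp
    next
      case 3
      then show ?thesis using ac by simp
    next
      case 4
      then have "(Y * S) $$ (a, c) = (\<Sum>j<b + n. if j = a - b then M (c - b) j else 0)"
        unfolding entry[OF ac] using ac by (intro sum.cong) (auto simp: Y_def S_def)
      then show ?thesis using 4 ac by simp
    qed
  qed (use carr in simp_all)
  then have "det (Y * S) = det ?B"
    by (rule arg_cong)
  also have "\<dots> = det (mat b b (\<lambda>(a, t). v a t)) * det (mat n n (\<lambda>(i, j). M j i))"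
    by (rule det_four_block_mat_upper_right_zero) (rule mat_carrier refl)+
  also have "det (mat n n (\<lambda>(i, j). M j i)) = det (mat n n (\<lambda>(i, j). M i j))"
    by (subst det_transpose[symmetric, of _ n]) (auto intro!: arg_cong[of _ _ det])
  finally have YS: "det Y = det (mat b b (\<lambda>(a, t). v a t)) * det (mat n n (\<lambda>(i, j). M i j))"
    using det_mult[OF carr(2,1)] det_S by simp
  have "det Y = (-1) ^ (b * n) * det (mat (b + n) (b + n)
      (\<lambda>(i, j). Y $$ (if i < n then i + b else if i < b + n then i - n else i, j)))"
    by (rule det_swap_initial_rows[OF carr(2)]) simp
  also have "mat (b + n) (b + n)
      (\<lambda>(i, j). Y $$ (if i < n then i + b else if i < b + n then i - n else i, j)) =
      four_block_mat (1\<^sub>m n) (0\<^sub>m n b) (mat b n (\<lambda>(a, t). v a t)) (mat b b (\<lambda>(a, t). v a (n + t)))"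
    by (rule eq_matI) (auto simp: Y_def)
  also have "det \<dots> = det (mat b b (\<lambda>(a, t). v a (n + t)))"
    by (simp add: det_four_block_mat_upper_right_zero[of _ n _ b])
  finally show ?thesis
    using YS by (simp add: mult.assoc flip: power_add mult_2)
qed

text \<open>
  A sequence on the integers that is symmetric about \<open>-1/2\<close> does not notice the corner term: the
  reflection moves the contribution of that term to negative indices, where it completes the
  truncated Toeplitz sum to a full one.
\<close>
lemma band_entry_action:
  fixes v :: "int \<Rightarrow> rat"
  assumes reflect: "\<And>j. v (- 1 - j) = v j" and "i < n"
  shows "(\<Sum>j<n + (r + 1). band_entry r i j * v (int j)) =
         (\<Sum>k\<le>r. of_nat (r choose k) * (v (int i + 1 + int k) + v (int i - 1 - int k)))"
proof -
  define N where "N = n + (r + 1)"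
  define f :: "nat \<Rightarrow> rat" where "f k = of_nat (r choose k)" for k
  have f_0: "f k = 0" if "r < k" for k using that by (simp add: f_def)
  have split: "(\<Sum>j<N. band_entry r i j * v (int j)) =
      (\<Sum>j<N. f (i + j) * v (int j)) + (\<Sum>j | j < N \<and> i < j. f (j - i - 1) * v (int j))
      + (\<Sum>j<i. f (i - j - 1) * v (int j))"
  proof -
    have "(\<Sum>j<N. band_entry r i j * v (int j)) = (\<Sum>j<N. f (i + j) * v (int j))
      + (\<Sum>j<N. if i < j then f (j - i - 1) * v (int j) else 0)
      + (\<Sum>j<N. if j < i then f (i - j - 1) * v (int j) else 0)"
      unfolding sum.distrib[symmetric]
      by (intro sum.cong) (auto simp: band_entry_def f_def algebra_simps)
    moreover have "{j. j < N \<and> j < i} = {..<i}" using assms(2) by (auto simp: N_def)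
    ultimately show ?thesis by (simp add: sum.If_cases lessThan_def Int_def)
  qed
  have "(\<Sum>j | j < N \<and> i < j. f (j - i - 1) * v (int j))
      = (\<Sum>k<N - (i + 1). f k * v (int i + 1 + int k))"
    by (rule sum.reindex_bij_witness[of _ "\<lambda>k. i + 1 + k" "\<lambda>j. j - i - 1"])
       (auto simp: of_nat_diff)
  also have "\<dots> = (\<Sum>k\<le>r. f k * v (int i + 1 + int k))"
    using assms(2) by (intro sum.mono_neutral_right) (auto simp: N_def f_0)
  finally have upper: "(\<Sum>j | j < N \<and> i < j. f (j - i - 1) * v (int j))
      = (\<Sum>k\<le>r. f k * v (int i + 1 + int k))" .
  have lower: "(\<Sum>j<i. f (i - j - 1) * v (int j)) = (\<Sum>k<i. f k * v (int i - 1 - int k))"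
    by (intro sum.reindex_bij_witness[of _ "\<lambda>k. i - 1 - k" "\<lambda>j. i - 1 - j"])
       (auto simp: of_nat_diff algebra_simps)
  have corner: "(\<Sum>j<N. f (i + j) * v (int j)) = (\<Sum>k\<in>{i..<i + N}. f k * v (int i - 1 - int k))"
  proof (intro sum.reindex_bij_witness[of _ "\<lambda>k. k - i" "\<lambda>j. i + j"])
    fix j
    have "v (int i - 1 - int (i + j)) = v (- 1 - int j)" by (simp add: algebra_simps)
    then show "f (i + j) * v (int i - 1 - int (i + j)) = f (i + j) * v (int j)"
      by (simp only: reflect)
  qed auto
  have "(\<Sum>k\<in>{i..<i + N}. f k * v (int i - 1 - int k)) + (\<Sum>k<i. f k * v (int i - 1 - int k))
      = (\<Sum>k<i + N. f k * v (int i - 1 - int k))"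
    by (subst sum.union_disjoint[symmetric]) (auto intro!: sum.cong)
  also have "\<dots> = (\<Sum>k\<le>r. f k * v (int i - 1 - int k))"
    by (rule sum.mono_neutral_right) (auto simp: N_def f_0)
  finally show ?thesis
    unfolding N_def[symmetric] split upper lower corner
    by (simp add: f_def sum.distrib distrib_left)
qed

section \<open>The kernel for r = 6\<close>

text \<open>
  For \<open>r = 6\<close> the Toeplitz operator has the symbol
  \<open>z (1 + z)\<^sup>6 + z\<^bsup>-1\<^esup> (1 + z\<^bsup>-1\<^esup>)\<^sup>6 = z\<^bsup>-7\<^esup> (1 + z)\<^sup>6 (1 + z\<^sup>8)\<close>.
  The factor \<open>1 + z\<^sup>8\<close> annihilates the sequences with \<open>v (j + 8) = - v j\<close>, and \<open>(1 + z)\<^sup>6\<close> annihilates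
  \<open>(-1)\<^sup>j p(j)\<close> for polynomials \<open>p\<close> of degree at most 5.  Among these, the ones symmetric about
  \<open>-1/2\<close> form a space of dimension \<open>4 + 3 = 7\<close>, which is the half-width of the band.

  For \<open>a < 4\<close> the sequence \<open>antiperiodic a\<close> is the symmetric and antiperiodic one with value 1 at \<open>a\<close> that
  vanishes at the other indices from 0 to 3; the rest is forced by
  \<open>v (7 - a) = - v (- 1 - a) = - v a\<close>.
\<close>
definition antiperiodic :: "nat \<Rightarrow> int \<Rightarrow> rat" where
  "antiperiodic a j = (if even (j div 8) then 1 else - 1) *
     (if j mod 8 = int a then 1 else if j mod 8 = 7 - int a then - 1 else 0)"

definition alternating :: "nat \<Rightarrow> int \<Rightarrow> rat" where
  "alternating e j = (if even j then 1 else - 1) * (2 * of_int j + 1) ^ e"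

definition kernel_seq :: "nat \<Rightarrow> int \<Rightarrow> rat" where
  "kernel_seq a = (if a < 4 then antiperiodic a else alternating (2 * (a - 4) + 1))"

lemma antiperiodic_reflect:
  assumes "a < 4"
  shows "antiperiodic a (- 1 - j) = antiperiodic a j"
proof -
  define q r where "q = j div 8" and "r = j mod 8"
  have "j = 8 * q + r" "0 \<le> r" "r < 8"
    by (simp_all add: q_def r_def)
  then have "- 1 - j = 8 * (- 1 - q) + (7 - r)" "0 \<le> 7 - r" "7 - r < 8"
    by simp_all
  then have "(- 1 - j) mod 8 = 7 - r" "(- 1 - j) div 8 = - 1 - q"
    by (rule int_mod_pos_eq, rule int_div_pos_eq)
  then show ?thesis
    using assms by (auto simp: antiperiodic_def q_def r_def)
qed

lemma antiperiodic_shift: "antiperiodic a (j + 8) = - antiperiodic a j"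
  by (simp add: antiperiodic_def)

lemma alternating_reflect:
  assumes "odd e"
  shows "alternating e (- 1 - j) = alternating e j"
proof -
  have "2 * rat_of_int (- 1 - j) + 1 = - (2 * of_int j + 1)" by simp
  then have "(2 * rat_of_int (- 1 - j) + 1) ^ e = - ((2 * of_int j + 1) ^ e)"
    by (simp only: power_minus_odd[OF assms])
  then show ?thesis
    unfolding alternating_def by (simp del: of_int_diff)
qed

lemma kernel_seq_reflect: "kernel_seq a (- 1 - j) = kernel_seq a j"
  by (simp add: kernel_seq_def antiperiodic_reflect alternating_reflect)

lemma sum_atMost_6: "(\<Sum>k\<le>6. g k) = g 0 + g 1 + g 2 + g 3 + g 4 + g 5 + g (6 :: nat)"
  for g :: "nat \<Rightarrow> rat"
  by (simp add: eval_nat_numeral)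

lemma binomial_6:
  "6 choose 0 = 1" "6 choose 1 = 6" "6 choose 2 = 15" "6 choose 3 = 20"
  "6 choose 4 = 15" "6 choose 5 = 6" "6 choose 6 = (1 :: nat)"
  by (simp_all add: eval_nat_numeral)

text \<open>
  Antiperiodic sequences pair the term \<open>k\<close> of the forward half with the term \<open>6 - k\<close> of the
  backward half, with the same binomial coefficient and opposite sign.  For the alternating
  sequences each half is, up to sign, a sixth difference of a polynomial of degree at most 5.
\<close>
lemma kernel_seq_annihilated:
  assumes "a < 7"
  shows "(\<Sum>k\<le>6. of_nat (6 choose k) *
           (kernel_seq a (i + 1 + int k) + kernel_seq a (i - 1 - int k))) = 0"
proof (cases "a < 4")
  case True
  note shift = antiperiodic_shift[of a]
  show ?thesis
    using True shift[of "i - 7"] shift[of "i - 6"] shift[of "i - 5"] shift[of "i - 4"]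
      shift[of "i - 3"] shift[of "i - 2"] shift[of "i - 1"]
    by (simp add: sum_atMost_6 binomial_6 kernel_seq_def algebra_simps)
next
  case False
  define s y :: rat where "s = (if even i then - 1 else 1)" and "y = 2 * of_int i + 1"
  have window: "alternating e (i + 1 + int k) = s * ((- 1) ^ k * (y + 2 * of_nat (k + 1)) ^ e)"
    "alternating e (i - 1 - int k) = s * ((- 1) ^ k * (y - 2 * of_nat (k + 1)) ^ e)" for e k
    by (auto simp: alternating_def s_def y_def algebra_simps)
  from False assms have "a \<in> {4, 5, 6}" by auto
  then obtain e where e: "kernel_seq a = alternating e" "e \<in> {1, 3, 5}"
    by (auto simp: kernel_seq_def)
  have "(\<Sum>k\<le>6. of_nat (6 choose k) *
           (kernel_seq a (i + 1 + int k) + kernel_seq a (i - 1 - int k))) =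
     s * (\<Sum>k\<le>6. of_nat (6 choose k) * (- 1) ^ k *
           ((y + 2 * of_nat (k + 1)) ^ e + (y - 2 * of_nat (k + 1)) ^ e))"
    unfolding e window sum_distrib_left by (intro sum.cong) (simp_all add: algebra_simps)
  also have "(\<Sum>k\<le>6. of_nat (6 choose k) * (- 1) ^ k *
           ((y + 2 * of_nat (k + 1)) ^ e + (y - 2 * of_nat (k + 1)) ^ e)) = 0"
  proof -
    \<comment> \<open>Adding the two halves leaves only the even powers of the step \<open>c\<close>, so that the sums over
      \<open>k\<close> become numerical.\<close>
    have "(y + c) ^ 3 + (y - c) ^ 3 = 2 * y ^ 3 + 6 * c\<^sup>2 * y"
      "(y + c) ^ 5 + (y - c) ^ 5 = 2 * y ^ 5 + 20 * c\<^sup>2 * y ^ 3 + 10 * c ^ 4 * y" for c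
      by (simp_all add: algebra_simps power_numeral_reduce)
    note pair = this
    from e(2) consider "e = 1" | "e = 3" | "e = 5" by auto
    then show ?thesis
      by cases (simp_all only: sum_atMost_6 pair, simp_all add: binomial_6)
  qed
  finally show ?thesis by simp
qed

lemma antiperiodic_shift_multiple:
  "antiperiodic a (8 * int m + j) = (- 1) ^ m * antiperiodic a j"
proof (induction m)
  case (Suc m)
  then show ?case
    using antiperiodic_shift[of a "8 * int m + j"] by (simp add: algebra_simps)
qed simp

definition kernel_window :: "nat \<Rightarrow> rat" where
  "kernel_window n = det (mat 7 7 (\<lambda>(a, t). kernel_seq a (int (n + t))))"

text \<open>
  The half-width of the band being 7, the Hankel determinant of order \<open>n\<close> reduces to a determinant
  of size 7 for every \<open>n\<close>, which enters only as a parameter of the entries.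
\<close>
lemma kernel_window_eq_hankel_det:
  "kernel_window n = (- 1) ^ n * kernel_window 0 * hankel_det (G 8) n"
proof -
  have "(\<Sum>j<n + 7. band_entry 6 i j * kernel_seq a (int j)) = 0" if "a < 7" "i < n" for a i
    using band_entry_action[of "kernel_seq a" i n 6, OF kernel_seq_reflect that(2)]
      kernel_seq_annihilated[OF that(1)] by simp
  then have "kernel_window n = (- 1) ^ (7 * n) * kernel_window 0 *
      det (mat n n (\<lambda>(i, j). band_entry 6 i j))"
    unfolding kernel_window_def
    by (intro band_det_via_kernel[of 7 "band_entry 6" n "\<lambda>a j. kernel_seq a (int j)", THEN trans])
       (auto simp: band_entry_def binomial_eq_0)
  also have "(- 1) ^ (7 * n) = ((- 1) ^ n :: rat)"
    by (simp add: power_mult)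
  finally show ?thesis
    using hankel_det_G_eq_band_det[of 6 n] by simp
qed

section \<open>Evaluation of the sparse determinants\<close>

text \<open>
  Expansion along the first row.  The test for a zero entry keeps the simplifier from evaluating
  minors with coefficient 0, which makes the expansion cheap for sparse leading rows.
\<close>
function laplace :: "'a :: comm_ring_1 list list \<Rightarrow> 'a" where
  "laplace [] = 1"
| "laplace (r # rs) =
     (\<Sum>j\<leftarrow>[0..<length r]. if r ! j = 0 then 0
        else (- 1) ^ j * r ! j * laplace (map (\<lambda>s. take j s @ drop (Suc j) s) rs))"
  by pat_completeness auto
termination by (relation "measure length") auto

lemma det_eq_laplace:
  assumes "length ls = n" and "\<And>s. s \<in> set ls \<Longrightarrow> length s = n"
  shows "det (mat n n (\<lambda>(i, j). ls ! i ! j)) = laplace ls"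
  using assms
proof (induction n arbitrary: ls)
  case 0
  then show ?case by simp
next
  case (Suc n)
  obtain r rs where ls: "ls = r # rs" using Suc.prems by (cases ls) auto
  have len: "length r = Suc n" "length rs = n" "\<And>s. s \<in> set rs \<Longrightarrow> length s = Suc n"
    using Suc.prems by (auto simp: ls)
  let ?A = "mat (Suc n) (Suc n) (\<lambda>(i, j). ls ! i ! j)"
  let ?minor = "\<lambda>j. map (\<lambda>s. take j s @ drop (Suc j) s) rs"
  have "det ?A = (\<Sum>j<Suc n. ?A $$ (0, j) * cofactor ?A 0 j)"
    by (rule laplace_expansion_row) auto
  also have "\<dots> = (\<Sum>j<Suc n. (- 1) ^ j * r ! j * laplace (?minor j))"
  proof (rule sum.cong)
    fix j assume "j \<in> {..<Suc n}"
    then have j: "j < Suc n" by simp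
    have "mat_delete ?A 0 j = mat n n (\<lambda>(a, b). ?minor j ! a ! b)"
    proof (rule eq_matI)
      fix a b
      assume "a < dim_row (mat n n (\<lambda>(a, b). ?minor j ! a ! b))"
        and "b < dim_col (mat n n (\<lambda>(a, b). ?minor j ! a ! b))"
      then have ab: "a < n" "b < n" by simp_all
      then have "length (rs ! a) = Suc n" using len by simp
      then show "mat_delete ?A 0 j $$ (a, b) = mat n n (\<lambda>(a, b). ?minor j ! a ! b) $$ (a, b)"
        using ab j len by (auto simp: mat_delete_def ls nth_append min_def)
    qed (simp_all add: mat_delete_def)
    moreover have "det (mat n n (\<lambda>(a, b). ?minor j ! a ! b)) = laplace (?minor j)"
      by (rule Suc.IH) (use len j in auto)
    ultimately show "?A $$ (0, j) * cofactor ?A 0 j = (- 1) ^ j * r ! j * laplace (?minor j)"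
      using j by (simp add: cofactor_def ls)
  qed simp
  also have "\<dots> = laplace ls"
    by (simp add: ls len interv_sum_list_conv_sum_set_nat atLeast0LessThan del: upt_Suc)
       (intro sum.cong arg_cong2[of _ _ _ _ "(+)"], auto)
  finally show ?case .
qed

text \<open>
  The two rules that drive the symbolic evaluation.  The test for zero is decidable by
  simplification in the sparse rows only, so rows of length at most 3, whose entries are
  polynomials, are expanded by an explicit formula.
\<close>
lemma laplace_long_row:
  assumes "3 < length r"
  shows "laplace (r # rs) = (\<Sum>j\<leftarrow>[0..<length r]. if r ! j = 0 then 0
        else (- 1) ^ j * r ! j * laplace (map (\<lambda>s. take j s @ drop (Suc j) s) rs))"
  by simp

lemma laplace_3:
  "laplace [[a, b, c], [d, e, f], [g, h, i]] =
     a * (e * i - f * h) - b * (d * i - f * g) + c * (d * h - e * g)"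
  by (simp add: algebra_simps)

text \<open>
  The entries of the window at \<open>n = 8 m + k\<close>, with \<open>s = (-1)\<^sup>m\<close> and \<open>y = 2 n + 1\<close>: four rows with
  entries in \<open>{0, s, -s}\<close> and three rows of alternating powers.
\<close>
definition window_rows :: "nat \<Rightarrow> rat \<Rightarrow> rat \<Rightarrow> rat list list" where
  "window_rows k s y =
     map (\<lambda>a. map (\<lambda>t. s * antiperiodic a (int (k + t))) [0..<7]) [0..<4] @
     map (\<lambda>e. map (\<lambda>t. (if even (k + t) then 1 else - 1) * (y + 2 * of_nat t) ^ e) [0..<7]) [1, 3, 5]"

lemma kernel_window_eq_laplace:
  "kernel_window (8 * m + k) =
     laplace (window_rows k ((- 1) ^ m) (16 * of_nat m + 2 * of_nat k + 1))"
proof -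
  let ?W = "window_rows k ((- 1) ^ m) (16 * of_nat m + 2 * of_nat k + 1)"
  have "kernel_seq a (int (8 * m + k + t)) = ?W ! a ! t" if "a < 7" "t < 7" for a t
  proof -
    have shift: "int (8 * m + k + t) = 8 * int m + int (k + t)" by simp
    have "antiperiodic a (int (8 * m + k + t)) = (- 1) ^ m * antiperiodic a (int (k + t))" if "a < 4"
      unfolding shift by (rule antiperiodic_shift_multiple)
    moreover have "alternating e (int (8 * m + k + t)) = (if even (k + t) then 1 else - 1) *
        (16 * of_nat m + 2 * of_nat k + 1 + 2 * of_nat t) ^ e" for e
      by (simp add: alternating_def algebra_simps)
    moreover from that(1) have "a < 4 \<or> a = 4 \<or> a = 5 \<or> a = 6" by auto
    then have "a < 4 \<and> kernel_seq a = antiperiodic a \<or> a = 4 \<and> kernel_seq a = alternating 1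
        \<or> a = 5 \<and> kernel_seq a = alternating 3 \<or> a = 6 \<and> kernel_seq a = alternating 5"
      by (elim disjE) (simp_all add: kernel_seq_def)
    ultimately show ?thesis
      using that(2) by (elim disjE conjE) (simp_all add: window_rows_def nth_append)
  qed
  then have "kernel_window (8 * m + k) = det (mat 7 7 (\<lambda>(a, t). ?W ! a ! t))"
    unfolding kernel_window_def by (intro arg_cong[of _ _ det] eq_matI) auto
  also have "\<dots> = laplace ?W"
    by (rule det_eq_laplace) (auto simp: window_rows_def)
  finally show ?thesis .
qed

lemma upt_4_7: "[0..<7] = [0, 1, 2, 3, 4, 5, 6 :: nat]" "[0..<4] = [0, 1, 2, 3 :: nat]"
  by (simp_all add: upt_rec)

text \<open>
  The four sparse rows leave at most \<open>2\<^sup>4\<close> minors of size 3 for each residue \<open>k\<close> of \<open>n\<close> modulo 8,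
  and these minors are polynomials in \<open>x = m\<close>.  All residues share the factor \<open>s\<^sup>4\<close>, one \<open>s\<close> from each
  sparse row, and up to sign the constant \<open>-368640\<close>, the value of the window at 0.  The value of
  \<open>s\<close> is left open because \<open>s \<noteq> 0\<close> is all that decides which entries vanish.
\<close>
lemma laplace_window_0:
  assumes "s \<noteq> 0"
  shows "laplace (window_rows 0 s (16 * x + 1)) = s ^ 4 * (- 368640)"
  using assms
  by (simp add: window_rows_def upt_4_7 antiperiodic_def laplace_long_row laplace_3
        del: laplace.simps(2))
     (simp add: algebra_simps power_numeral_reduce)

lemma laplace_window_1:
  assumes "s \<noteq> 0"
  shows "laplace (window_rows 1 s (16 * x + 3)) = s ^ 4 * 368640"
  using assms
  by (simp add: window_rows_def upt_4_7 antiperiodic_def laplace_long_row laplace_3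
        del: laplace.simps(2))
     (simp add: algebra_simps power_numeral_reduce)

lemma laplace_window_2:
  assumes "s \<noteq> 0"
  shows "laplace (window_rows 2 s (16 * x + 5)) = s ^ 4 * (- 368640) *
    (- (2 / 15) * (x + 1) * (256 * x^2 + 192 * x + 15) * (256 * x^2 + 192 * x + 17))"
  using assms
  by (simp add: window_rows_def upt_4_7 antiperiodic_def laplace_long_row laplace_3
        del: laplace.simps(2))
     (simp add: algebra_simps power_numeral_reduce)

lemma laplace_window_3:
  assumes "s \<noteq> 0"
  shows "laplace (window_rows 3 s (16 * x + 7)) = s ^ 4 * 368640 *
    (16 / 45 * (65536 * x^4 + 262144 * x^3 + 272896 * x^2 + 79104 * x - 3915) * (x + 1)^2)"
  using assms
  by (simp add: window_rows_def upt_4_7 antiperiodic_def laplace_long_row laplace_3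
        del: laplace.simps(2))
     (simp add: algebra_simps power_numeral_reduce)

lemma laplace_window_4:
  assumes "s \<noteq> 0"
  shows "laplace (window_rows 4 s (16 * x + 9)) = s ^ 4 * (- 368640) *
    (4096 * (x + 1)^3)"
  using assms
  by (simp add: window_rows_def upt_4_7 antiperiodic_def laplace_long_row laplace_3
        del: laplace.simps(2))
     (simp add: algebra_simps power_numeral_reduce)

lemma laplace_window_5:
  assumes "s \<noteq> 0"
  shows "laplace (window_rows 5 s (16 * x + 11)) = s ^ 4 * 368640 *
    (- 4096 * (x + 1)^3)"
  using assms
  by (simp add: window_rows_def upt_4_7 antiperiodic_def laplace_long_row laplace_3
        del: laplace.simps(2))
     (simp add: algebra_simps power_numeral_reduce)

lemma laplace_window_6:
  assumes "s \<noteq> 0"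
  shows "laplace (window_rows 6 s (16 * x + 13)) = s ^ 4 * (- 368640) *
    (16 / 45 * (65536 * x^4 + 262144 * x^3 + 272896 * x^2 - 36096 * x - 119115) * (x + 1)^2)"
  using assms
  by (simp add: window_rows_def upt_4_7 antiperiodic_def laplace_long_row laplace_3
        del: laplace.simps(2))
     (simp add: algebra_simps power_numeral_reduce)

lemma laplace_window_7:
  assumes "s \<noteq> 0"
  shows "laplace (window_rows 7 s (16 * x + 15)) = s ^ 4 * 368640 *
    (2 / 15 * (x + 1) * (256 * x^2 + 832 * x + 655) * (256 * x^2 + 832 * x + 657))"
  using assms
  by (simp add: window_rows_def upt_4_7 antiperiodic_def laplace_long_row laplace_3
        del: laplace.simps(2))
     (simp add: algebra_simps power_numeral_reduce)

lemma hankel_det_G_8: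
  "hankel_det (G 8) (8 * m + k) = (- 1) ^ k *
     laplace (window_rows k ((- 1) ^ m) (16 * of_nat m + (2 * of_nat k + 1))) / (- 368640)"
proof -
  have "kernel_window 0 = - 368640"
    using kernel_window_eq_laplace[of 0 0] laplace_window_0[of 1 0] by simp
  moreover have "(- 1) ^ (8 * m + k) = ((- 1) ^ k :: rat)"
    by (simp add: power_add power_mult)
  ultimately have "kernel_window (8 * m + k) = (- 1) ^ k * (- 368640) * hankel_det (G 8) (8 * m + k)"
    using kernel_window_eq_hankel_det[of "8 * m + k"] by simp
  then have "(- 1) ^ k * kernel_window (8 * m + k) = (- 368640) * hankel_det (G 8) (8 * m + k)"
    by simp
  then show ?thesis
    by (simp add: kernel_window_eq_laplace add.assoc)
qed

section \<open>The Hankel determinants of G 8\<close>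

theorem theorem20:
  fixes n :: nat
  shows "let H = hankel_det (G 8); x = (of_nat n :: rat) in
      H (8 * n) = 1 \<and>
      H (8 * n + 1) = 1 \<and>
      H (8 * n + 2) =
        - (2 / 15) * (x + 1) * (256 * x^2 + 192 * x + 15) * (256 * x^2 + 192 * x + 17) \<and>
      H (8 * n + 3) =
        16 / 45 * (65536 * x^4 + 262144 * x^3 + 272896 * x^2 + 79104 * x - 3915) * (x + 1)^2 \<and>
      H (8 * n + 4) = 4096 * (x + 1)^3 \<and>
      - H (8 * n + 5) = 4096 * (x + 1)^3 \<and>
      H (8 * n + 6) =
        16 / 45 * (65536 * x^4 + 262144 * x^3 + 272896 * x^2 - 36096 * x - 119115) * (x + 1)^2 \<and>
      H (8 * n + 7) =
        2 / 15 * (x + 1) * (256 * x^2 + 832 * x + 655) * (256 * x^2 + 832 * x + 657)"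
proof -
  let ?s = "(- 1) ^ n :: rat" and ?x = "of_nat n :: rat"
  have s: "?s \<noteq> 0" "?s ^ 4 = 1"
    by (simp_all add: power_mult[symmetric])
  note window = laplace_window_0[OF s(1), of ?x] laplace_window_1[OF s(1), of ?x]
    laplace_window_2[OF s(1), of ?x] laplace_window_3[OF s(1), of ?x]
    laplace_window_4[OF s(1), of ?x] laplace_window_5[OF s(1), of ?x]
    laplace_window_6[OF s(1), of ?x] laplace_window_7[OF s(1), of ?x]
  note residue = hankel_det_G_8[of n]
  show ?thesis
    unfolding Let_def
    using residue[of 0] residue[of 1] residue[of 2] residue[of 3]
      residue[of 4] residue[of 5] residue[of 6] residue[of 7]
    by (simp add: window s(2) del: One_nat_def)
qed

end
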